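(* The complexity function $p(n)$ of the big subshift $\Sigma$ is superpolynomial: for each $k=2,3,\dots$ there are at least $2^{k-1}$ distinct blocks of length $(k+1)(k+2)/2$ in the language $\mathscr L(\Sigma)$ of the big subshift.
   Context: The Pascal graph has vertex set $\mathscr V=\{(x,y):x,y\in\mathbb Z_{\ge0}\}$ and, for each $(x,y)\in\mathscr V$, one directed edge from $(x,y)$ to $(x+1,y)$ and one to $(x,y+1)$. The root is $(0,0)$. An ordering is a function $\xi:\mathscr V\to\{0,1\}$: for $x,y\ge1$ the edge from $(x-1,y)$ to $(x,y)$ is less than the edge from $(x,y-1)$ to $(x,y)$ if and only if $\xi(x,y)=1$ (the values of $\xi$ at vertices with $x=0$ or $y=0$ play no role; the unique edge entering such a non-root vertex is both minimal and maximal). $X$ is the set of infinite directed paths starting at the root. Distinct paths $\gamma,\eta$ that eventually coincide are compared by $\gamma<\eta$ iff $\gamma_n<\eta_n$, where $n$ is the largest index with $\gamma_n\ne\eta_n$. For a path $\gamma$ not consisting entirely of maximal edges, $T_\xi\gamma$ is the smallest path larger than $\gamma$; $T_\xi^{-1}$ is defined on paths not consisting entirely of minimal edges. The $1$-coding of $\gamma\in X$ is the (possibly one-sided or finite) sequence over $\{a,b\}$ whose $n$-th entry, whenever $T_\xi^n\gamma$ is defined ($n\in\mathbb Z$), is $a$ if the first edge of $T_\xi^n\gamma$ goes from $(0,0)$ to $(1,0)$ and $b$ if it goes to $(0,1)$. For an ordering $\xi$, $\Sigma_\xi\subset\{a,b\}^{\mathbb Z}$ is the set of all two-sided sequences each of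 whose finite subblocks can be found in the $1$-coding (for $\xi$) of some $\gamma\in X$. $\mathscr L(\Omega)$ denotes the set of finite blocks seen in sequences of a subshift $\Omega$. The big subshift $\Sigma$ is the subshift of $\{a,b\}^{\mathbb Z}$ with $\mathscr L(\Sigma)=\bigcup_\xi\mathscr L(\Sigma_\xi)$, the union over all orderings $\xi$ (equivalently, $\Sigma$ is the closure of $\bigcup_\xi\Sigma_\xi$). The complexity function $p(n)$ is the number of blocks of length $n$ in $\mathscr L(\Sigma)$; superpolynomial means growing faster than every polynomial in $n$. *)

theory Defs
  imports
    "HOL-Analysis.Function_Topology"
    "HOL-Computational_Algebra.Polynomial"
    "HOL-Library.Landau_Symbols"
begin

type_synonym vertex = "nat \<times> nat"
type_synonym edge = "vertex \<times> vertex"  \<comment> \<open>(source, target); the graph has no parallel edges\<close>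
type_synonym path = "nat \<Rightarrow> edge"

definition pascal_edges :: "edge set" where
  "pascal_edges = {((x, y), (Suc x, y)) | x y. True} \<union> {((x, y), (x, Suc y)) | x y. True}"

definition paths :: "path set" where
  "paths = {\<gamma>. fst (\<gamma> 0) = (0, 0) \<and> (\<forall>n. \<gamma> n \<in> pascal_edges \<and> fst (\<gamma> (Suc n)) = snd (\<gamma> n))}"

text \<open>An ordering assigns a bit to each vertex, \<open>True\<close> standing for 1. The bits at vertices with
  a zero coordinate are never consulted.\<close>

type_synonym ordering = "vertex \<Rightarrow> bool"

definition edge_less :: "ordering \<Rightarrow> edge \<Rightarrow> edge \<Rightarrow> bool" where
  "edge_less \<xi> e f \<longleftrightarrow> (\<exists>x\<ge>1. \<exists>y\<ge>1.
     (\<xi> (x, y) \<and> e = ((x - 1, y), (x, y)) \<and> f = ((x, y - 1), (x, y))) \<or>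
     (\<not> \<xi> (x, y) \<and> e = ((x, y - 1), (x, y)) \<and> f = ((x - 1, y), (x, y))))"

definition maximal_edge :: "ordering \<Rightarrow> edge \<Rightarrow> bool" where
  "maximal_edge \<xi> e \<longleftrightarrow> e \<in> pascal_edges \<and> \<not> (\<exists>f. edge_less \<xi> e f)"

definition minimal_edge :: "ordering \<Rightarrow> edge \<Rightarrow> bool" where
  "minimal_edge \<xi> e \<longleftrightarrow> e \<in> pascal_edges \<and> \<not> (\<exists>f. edge_less \<xi> f e)"

text \<open>A partial order: only paths that eventually coincide are comparable.\<close>

definition path_less :: "ordering \<Rightarrow> path \<Rightarrow> path \<Rightarrow> bool" where
  "path_less \<xi> \<gamma> \<eta> \<longleftrightarrow>
     (\<exists>n. \<gamma> n \<noteq> \<eta> n \<and> (\<forall>m>n. \<gamma> m = \<eta> m) \<and> edge_less \<xi> (\<gamma> n) (\<eta> n))"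

definition is_next_path :: "ordering \<Rightarrow> path \<Rightarrow> path \<Rightarrow> bool" where
  "is_next_path \<xi> \<gamma> \<eta> \<longleftrightarrow> \<eta> \<in> paths \<and> path_less \<xi> \<gamma> \<eta> \<and>
     (\<forall>\<zeta>\<in>paths. path_less \<xi> \<gamma> \<zeta> \<longrightarrow> \<eta> = \<zeta> \<or> path_less \<xi> \<eta> \<zeta>)"

definition adic :: "ordering \<Rightarrow> path \<Rightarrow> path option" where
  "adic \<xi> \<gamma> = (if \<forall>n. maximal_edge \<xi> (\<gamma> n) then None else Some (THE \<eta>. is_next_path \<xi> \<gamma> \<eta>))"

definition adic_inv :: "ordering \<Rightarrow> path \<Rightarrow> path option" where
  "adic_inv \<xi> \<eta> = (if \<forall>n. minimal_edge \<xi> (\<eta> n) then None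
     else Some (THE \<gamma>. \<gamma> \<in> paths \<and> adic \<xi> \<gamma> = Some \<eta>))"

text \<open>Integer iterates of the adic map; \<open>None\<close> once an intermediate iterate is undefined.\<close>

definition adic_pow :: "ordering \<Rightarrow> int \<Rightarrow> path \<Rightarrow> path option" where
  "adic_pow \<xi> n \<gamma> =
     (if n \<ge> 0 then ((\<lambda>p. Option.bind p (adic \<xi>)) ^^ nat n) (Some \<gamma>)
      else ((\<lambda>p. Option.bind p (adic_inv \<xi>)) ^^ nat (- n)) (Some \<gamma>))"

datatype letter = letter_a | letter_b

definition coding1 :: "ordering \<Rightarrow> path \<Rightarrow> int \<Rightarrow> letter option" where
  "coding1 \<xi> \<gamma> n =
     map_option (\<lambda>\<eta>. if \<eta> 0 = ((0, 0), (1, 0)) then letter_a else letter_b) (adic_pow \<xi> n \<gamma>)"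

definition block_in_coding :: "letter list \<Rightarrow> (int \<Rightarrow> letter option) \<Rightarrow> bool" where
  "block_in_coding w c \<longleftrightarrow> (\<exists>i. \<forall>j<length w. c (i + int j) = Some (w ! j))"

definition block_at :: "(int \<Rightarrow> 'a) \<Rightarrow> int \<Rightarrow> nat \<Rightarrow> 'a list" where
  "block_at s i n = map (\<lambda>j. s (i + int j)) [0..<n]"

definition lang :: "(int \<Rightarrow> 'a) set \<Rightarrow> 'a list set" where
  "lang \<Omega> = {block_at s i n | s i n. s \<in> \<Omega>}"

definition ordering_subshift :: "ordering \<Rightarrow> (int \<Rightarrow> letter) set" where
  "ordering_subshift \<xi> =
     {s. \<forall>i n. \<exists>\<gamma>\<in>paths. block_in_coding (block_at s i n) (coding1 \<xi> \<gamma>)}"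

definition full_shift_topology :: "(int \<Rightarrow> 'a) topology" where
  "full_shift_topology = product_topology (\<lambda>_. discrete_topology UNIV) UNIV"

definition is_subshift :: "(int \<Rightarrow> 'a) set \<Rightarrow> bool" where
  "is_subshift \<Omega> \<longleftrightarrow>
     closedin full_shift_topology \<Omega> \<and> (\<lambda>s i. s (i + 1)) ` \<Omega> = \<Omega>"

definition big_subshift :: "(int \<Rightarrow> letter) set" where
  "big_subshift = full_shift_topology closure_of (\<Union>\<xi>. ordering_subshift \<xi>)"

definition complexity :: "(int \<Rightarrow> 'a) set \<Rightarrow> nat \<Rightarrow> nat" where
  "complexity \<Omega> n = card {w \<in> lang \<Omega>. length w = n}"

definition superpolynomial :: "(nat \<Rightarrow> real) \<Rightarrow> bool" where
  "superpolynomial f \<longleftrightarrow> (\<forall>q :: real poly. (\<lambda>n. poly q (real n)) \<in> o(f))"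

lemma block_at_eq_iff: "block_at s i n = block_at t i n \<longleftrightarrow> (\<forall>k\<in>{i..<i + int n}. s k = t k)"
proof
  assume L: "block_at s i n = block_at t i n"
  show "\<forall>k\<in>{i..<i + int n}. s k = t k"
  proof
    fix k assume k: "k \<in> {i..<i + int n}"
    then have "nat (k - i) < n" by auto
    moreover have "block_at s i n ! nat (k - i) = block_at t i n ! nat (k - i)" using L by simp
    ultimately show "s k = t k" using k by (simp add: block_at_def)
  qed
qed (auto simp: block_at_def)

lemma block_at_shift: "block_at (\<lambda>k. s (k + c)) i n = block_at s (i + c) n"
  by (simp add: block_at_def algebra_simps)

lemma mem_closure_of_full_shift:
  "s \<in> full_shift_topology closure_of S \<longleftrightarrow> (\<forall>i n. \<exists>t\<in>S. block_at t i n = block_at s i n)"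
proof
  assume L: "s \<in> full_shift_topology closure_of S"
  show "\<forall>i n. \<exists>t\<in>S. block_at t i n = block_at s i n"
  proof (intro allI)
    fix i n
    let ?X = "\<lambda>k. if k \<in> {i..<i + int n} then {s k} else UNIV"
    have "openin full_shift_topology (PiE UNIV ?X)"
      unfolding full_shift_topology_def
      by (rule product_topology_basis, simp, rule finite_subset[of _ "{i..<i + int n}"]) auto
    moreover have "s \<in> PiE UNIV ?X" by auto
    ultimately obtain t where "t \<in> S" "t \<in> PiE UNIV ?X"
      using L unfolding in_closure_of by meson
    have "t k \<in> ?X k" for k
      using PiE_mem[OF \<open>t \<in> PiE UNIV ?X\<close>, of k] by simp
    then have "t k = s k" if "k \<in> {i..<i + int n}" for k
      using that by (metis singletonD)
    then have "block_at t i n = block_at s i n"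
      unfolding block_at_eq_iff by simp
    with \<open>t \<in> S\<close> show "\<exists>t\<in>S. block_at t i n = block_at s i n" by blast
  qed
next
  assume R: "\<forall>i n. \<exists>t\<in>S. block_at t i n = block_at s i n"
  show "s \<in> full_shift_topology closure_of S"
    unfolding in_closure_of
  proof (intro conjI allI impI)
    show "s \<in> topspace full_shift_topology" by (simp add: full_shift_topology_def)
    fix T assume "s \<in> T \<and> openin full_shift_topology T"
    then obtain U where U: "finite {k. U k \<noteq> UNIV}" "s \<in> PiE UNIV U" "PiE UNIV U \<subseteq> T"
      unfolding full_shift_topology_def openin_product_topology_alt
      by (metis (no_types, lifting) Collect_cong UNIV_I topspace_discrete_topology)
    obtain M where M: "\<And>k. U k \<noteq> UNIV \<Longrightarrow> \<bar>k\<bar> \<le> M"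
    proof
      show "\<bar>k\<bar> \<le> Max (abs ` {k. U k \<noteq> UNIV})" if "U k \<noteq> UNIV" for k
        by (rule Max_ge) (use U(1) that in auto)
    qed
    obtain t where t: "t \<in> S" "block_at t (- \<bar>M\<bar>) (nat (2 * \<bar>M\<bar> + 1)) = block_at s (- \<bar>M\<bar>) (nat (2 * \<bar>M\<bar> + 1))"
      using R by blast
    have "t k \<in> U k" for k
    proof (cases "U k = UNIV")
      case False
      have "k \<in> {- \<bar>M\<bar>..<- \<bar>M\<bar> + int (nat (2 * \<bar>M\<bar> + 1))}"
        using M[OF False] by auto
      then have "t k = s k" using t(2) unfolding block_at_eq_iff by blast
      then show ?thesis using U(2) by auto
    qed auto
    then show "\<exists>t. t \<in> S \<and> t \<in> T" using t(1) U(3) by blast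
  qed
qed

lemma big_subshift_iff:
  "s \<in> big_subshift \<longleftrightarrow> (\<forall>i n. block_at s i n \<in> (\<Union>\<xi>. lang (ordering_subshift \<xi>)))"
proof -
  have *: "(\<exists>t\<in>(\<Union>\<xi>. ordering_subshift \<xi>). block_at t i n = block_at s i n) \<longleftrightarrow>
      block_at s i n \<in> (\<Union>\<xi>. lang (ordering_subshift \<xi>))" for i n
  proof
    assume "block_at s i n \<in> (\<Union>\<xi>. lang (ordering_subshift \<xi>))"
    then obtain \<xi> t i' n' where t: "t \<in> ordering_subshift \<xi>" "block_at s i n = block_at t i' n'"
      by (auto simp: lang_def)
    have "length (block_at s i n) = length (block_at t i' n')" using t(2) by simp
    then have "n' = n" by (simp add: block_at_def)
    define t' where "t' = (\<lambda>k. t (k + (i' - i)))"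
    have "t' \<in> ordering_subshift \<xi>"
      using t(1) by (auto simp: t'_def ordering_subshift_def block_at_shift)
    moreover have "block_at t' i n = block_at s i n"
      using t(2) \<open>n' = n\<close> by (simp add: t'_def block_at_shift)
    ultimately show "\<exists>t\<in>(\<Union>\<xi>. ordering_subshift \<xi>). block_at t i n = block_at s i n" by blast
  next
    assume "\<exists>t\<in>(\<Union>\<xi>. ordering_subshift \<xi>). block_at t i n = block_at s i n"
    then obtain \<xi> t where "t \<in> ordering_subshift \<xi>" "block_at s i n = block_at t i n"
      by (metis UN_E)
    then show "block_at s i n \<in> (\<Union>\<xi>. lang (ordering_subshift \<xi>))"
      unfolding lang_def by blast
  qed
  show ?thesis unfolding big_subshift_def mem_closure_of_full_shift * ..
qed

lemma lang_big_subshift: "lang big_subshift = (\<Union>\<xi>. lang (ordering_subshift \<xi>))"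
proof
  show "lang big_subshift \<subseteq> (\<Union>\<xi>. lang (ordering_subshift \<xi>))"
    unfolding lang_def[of big_subshift] using big_subshift_iff by blast
  have "ordering_subshift \<xi> \<subseteq> big_subshift" for \<xi>
    unfolding subset_iff big_subshift_iff lang_def by blast
  then show "(\<Union>\<xi>. lang (ordering_subshift \<xi>)) \<subseteq> lang big_subshift"
    unfolding lang_def by blast
qed

lemma is_subshift_big_subshift: "is_subshift big_subshift"
proof -
  have shift: "(\<lambda>i. s (i + c)) \<in> big_subshift" if "s \<in> big_subshift" for s c
    using that unfolding big_subshift_iff block_at_shift by blast
  have "s \<in> (\<lambda>s i. s (i + 1)) ` big_subshift" if "s \<in> big_subshift" for s
    by (rule image_eqI[where x = "\<lambda>i. s (i + (- 1))"]) (use shift[OF that, of "- 1"] in auto)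
  then show ?thesis
    using shift[of _ 1] unfolding is_subshift_def big_subshift_def by auto
qed

end

theory Submission
  imports Defs "HOL-Real_Asymp.Real_Asymp" "HOL-Library.Discrete_Functions"
begin

text \<open>The paths through a vertex \<open>(x, y)\<close> with a common continuation are linearly ordered, and
  the adic map runs through them one after the other. Reading off their first letters gives the basic
  block at \<open>(x, y)\<close>, a word of length \<open>x + y choose x\<close>, which is the concatenation of the basic
  blocks at the two predecessors of \<open>(x, y)\<close> in the order given by \<open>\<xi> (x, y)\<close>.

  Take an ordering for which the basic block at \<open>(j, 1)\<close> is \<open>a\<^sup>j b\<close>. Then the basic block at
  \<open>(k, 2)\<close> arises from the word \<open>b\<close> by attaching \<open>a b\<close>, \<open>a a b\<close> and so on up to \<open>a\<^sup>k b\<close>, each on the left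
  or on the right as the ordering wishes. The longest run of \<open>a\<close> reveals the last choice, so by
  induction all choices can be recovered (\<open>second_row_block_inj\<close>). This gives \<open>2\<^sup>k\<close> words of length
  \<open>(k + 2) choose 2\<close>.

  These words must moreover occur in two-sided sequences of the subshift. For that, let the
  ordering alternate along each column above the second row. The path that turns up into column
  \<open>k\<close> for good then gains, step by step, larger paths and smaller paths in turn
  (\<open>corner_path_deep\<close>); hence all its iterates under the adic map and its inverse are defined, and its
  coding is a point of the subshift that contains the basic block at \<open>(k, 2)\<close>
  (\<open>basic_block_in_lang\<close>).

  Finally, complexity is monotone because every word of the language extends to the right. So it is
  at least of order \<open>2 powr sqrt n\<close>, and this beats every polynomial.\<close>

section \<open>The order on paths\<close>

lemma edge_less_iff:
  "edge_less \<xi> e f \<longleftrightarrow> (\<exists>x y.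
     (\<xi> (Suc x, Suc y) \<and> e = ((x, Suc y), (Suc x, Suc y)) \<and> f = ((Suc x, y), (Suc x, Suc y))) \<or>
     (\<not> \<xi> (Suc x, Suc y) \<and> e = ((Suc x, y), (Suc x, Suc y)) \<and> f = ((x, Suc y), (Suc x, Suc y))))"
proof -
  have "(\<exists>n\<ge>1. P n) \<longleftrightarrow> (\<exists>n. P (Suc n))" for P
    by (metis One_nat_def Suc_le_D Suc_le_mono le0)
  then show ?thesis by (simp add: edge_less_def)
qed

lemma edge_lessD:
  assumes "edge_less \<xi> e f"
  shows "e \<in> pascal_edges" "f \<in> pascal_edges" "snd e = snd f" "e \<noteq> f" "\<not> edge_less \<xi> f e"
proof -
  show "e \<in> pascal_edges" "f \<in> pascal_edges" "snd e = snd f" "e \<noteq> f"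
    using assms unfolding edge_less_iff by (auto simp: pascal_edges_def)
  show "\<not> edge_less \<xi> f e"
  proof
    assume "edge_less \<xi> f e"
    with assms show False unfolding edge_less_iff by (elim exE disjE) simp_all
  qed
qed

lemma edge_less_into_Suc:
  shows "\<xi> (Suc x, Suc y) \<Longrightarrow>
      edge_less \<xi> ((x, Suc y), (Suc x, Suc y)) ((Suc x, y), (Suc x, Suc y))"
    and "\<not> \<xi> (Suc x, Suc y) \<Longrightarrow>
      edge_less \<xi> ((Suc x, y), (Suc x, Suc y)) ((x, Suc y), (Suc x, Suc y))"
  unfolding edge_less_iff by auto

lemma edge_less_total:
  assumes "e \<in> pascal_edges" "f \<in> pascal_edges" "snd e = snd f" "e \<noteq> f"
  shows "edge_less \<xi> e f \<or> edge_less \<xi> f e"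
proof -
  obtain x y where "{e, f} = {((x, Suc y), (Suc x, Suc y)), ((Suc x, y), (Suc x, Suc y))}"
    using assms by (fastforce simp: pascal_edges_def)
  then show ?thesis using edge_less_into_Suc[of \<xi> x y] by (fastforce simp: doubleton_eq_iff)
qed

lemma path_edge: "\<gamma> \<in> paths \<Longrightarrow> \<gamma> n \<in> pascal_edges"
  and path_step: "\<gamma> \<in> paths \<Longrightarrow> fst (\<gamma> (Suc n)) = snd (\<gamma> n)"
  by (auto simp: paths_def)

lemma path_level:
  assumes "\<gamma> \<in> paths"
  shows "fst (fst (\<gamma> n)) + snd (fst (\<gamma> n)) = n"
proof (induction n)
  case 0
  show ?case using assms by (simp add: paths_def)
next
  case (Suc n)
  then show ?case using path_step[OF assms, of n] path_edge[OF assms, of n]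
    by (auto simp: pascal_edges_def)
qed

lemma path_less_asym:
  assumes "path_less \<xi> \<gamma> \<eta>" shows "\<not> path_less \<xi> \<eta> \<gamma>"
proof
  assume "path_less \<xi> \<eta> \<gamma>"
  then obtain m where m: "\<eta> m \<noteq> \<gamma> m" "\<forall>l>m. \<eta> l = \<gamma> l" "edge_less \<xi> (\<eta> m) (\<gamma> m)"
    unfolding path_less_def by blast
  obtain n where n: "\<gamma> n \<noteq> \<eta> n" "\<forall>l>n. \<gamma> l = \<eta> l" "edge_less \<xi> (\<gamma> n) (\<eta> n)"
    using assms unfolding path_less_def by blast
  have "m = n" using m n by (metis linorder_neqE_nat)
  then show False using m n edge_lessD(5) by metis
qed

lemma path_less_irrefl: "\<not> path_less \<xi> \<gamma> \<gamma>"
  by (simp add: path_less_def)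

text \<open>At the last index where two cofinal paths differ, both enter the same vertex, and the two
  edges into a vertex are comparable.\<close>

lemma path_less_total:
  assumes "\<gamma> \<in> paths" "\<eta> \<in> paths" "\<gamma> \<noteq> \<eta>" and agree: "\<forall>m\<ge>N. \<gamma> m = \<eta> m"
  shows "path_less \<xi> \<gamma> \<eta> \<or> path_less \<xi> \<eta> \<gamma>"
proof -
  define n where "n = Max {m. \<gamma> m \<noteq> \<eta> m}"
  have "{m. \<gamma> m \<noteq> \<eta> m} \<subseteq> {..<N}" using agree by (auto simp: not_le[symmetric])
  then have fin: "finite {m. \<gamma> m \<noteq> \<eta> m}" using finite_subset by blast
  moreover have "{m. \<gamma> m \<noteq> \<eta> m} \<noteq> {}" using assms(3) by (auto simp: fun_eq_iff)
  ultimately have n: "\<gamma> n \<noteq> \<eta> n" using Max_in unfolding n_def by blast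
  have after: "\<gamma> m = \<eta> m" if "m > n" for m
    using that Max_ge[OF fin, of m] by (force simp: n_def)
  have "snd (\<gamma> n) = snd (\<eta> n)"
    using after[of "Suc n"] assms(1,2) path_step by (metis lessI)
  then have "edge_less \<xi> (\<gamma> n) (\<eta> n) \<or> edge_less \<xi> (\<eta> n) (\<gamma> n)"
    using edge_less_total n assms(1,2) path_edge by metis
  then show ?thesis unfolding path_less_def using n after by metis
qed

section \<open>Sorted lists of paths with a common tail\<close>

definition via :: "edge \<Rightarrow> path \<Rightarrow> path" where
  "via e \<tau> = \<tau>(fst (fst e) + snd (fst e) := e)"

definition append_if :: "bool \<Rightarrow> 'a list \<Rightarrow> 'a list \<Rightarrow> 'a list" where
  "append_if b xs ys = (if b then xs @ ys else ys @ xs)"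

text \<open>The list of all paths that pass through \<open>(x, y)\<close> and follow \<open>\<tau>\<close> from there on, in
  increasing order. A path with a smaller last edge into \<open>(x, y)\<close> is smaller, whatever it did
  before; so the list is the concatenation of the lists for the two predecessors of \<open>(x, y)\<close>, in the
  order that \<open>\<xi>\<close> prescribes. The values of \<open>\<tau>\<close> below the level of \<open>(x, y)\<close> are overwritten.\<close>

fun fan :: "ordering \<Rightarrow> nat \<Rightarrow> nat \<Rightarrow> path \<Rightarrow> path list" where
  "fan \<xi> 0 0 \<tau> = [\<tau>]"
| "fan \<xi> (Suc x) 0 \<tau> = fan \<xi> x 0 (via ((x, 0), (Suc x, 0)) \<tau>)"
| "fan \<xi> 0 (Suc y) \<tau> = fan \<xi> 0 y (via ((0, y), (0, Suc y)) \<tau>)"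
| "fan \<xi> (Suc x) (Suc y) \<tau> = append_if (\<xi> (Suc x, Suc y))
     (fan \<xi> x (Suc y) (via ((x, Suc y), (Suc x, Suc y)) \<tau>))
     (fan \<xi> (Suc x) y (via ((Suc x, y), (Suc x, Suc y)) \<tau>))"

lemmas fan_induct = fan.induct[case_names root bottom left inner]

definition tail_from :: "nat \<Rightarrow> nat \<Rightarrow> path \<Rightarrow> bool" where
  "tail_from x y \<tau> \<longleftrightarrow> fst (\<tau> (x + y)) = (x, y) \<and>
     (\<forall>m\<ge>x + y. \<tau> m \<in> pascal_edges \<and> fst (\<tau> (Suc m)) = snd (\<tau> m))"

definition same_tail :: "nat \<Rightarrow> path \<Rightarrow> path set" where
  "same_tail n \<tau> = {\<gamma> \<in> paths. \<forall>m\<ge>n. \<gamma> m = \<tau> m}"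

lemma same_tail_via:
  "same_tail (x + y) (via ((x, y), v) \<tau>) =
    {\<gamma> \<in> same_tail (Suc (x + y)) \<tau>. \<gamma> (x + y) = ((x, y), v)}"
  unfolding same_tail_def via_def by (auto simp: Suc_le_eq order.strict_iff_order)

lemma tail_from_via:
  assumes "tail_from x y \<tau>" "((x', y'), (x, y)) \<in> pascal_edges"
  shows "tail_from x' y' (via ((x', y'), (x, y)) \<tau>)"
proof -
  have "x + y = Suc (x' + y')" using assms(2) by (auto simp: pascal_edges_def)
  then show ?thesis using assms by (auto simp: tail_from_def via_def Suc_le_eq)
qed

lemma tail_from_path: "\<gamma> \<in> paths \<Longrightarrow> fst (\<gamma> (x + y)) = (x, y) \<Longrightarrow> tail_from x y \<gamma>"
  by (auto simp: tail_from_def paths_def)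

lemma tail_from_pred:
  "tail_from (Suc x) y \<tau> \<Longrightarrow> tail_from x y (via ((x, y), (Suc x, y)) \<tau>)"
  "tail_from x (Suc y) \<tau> \<Longrightarrow> tail_from x y (via ((x, y), (x, Suc y)) \<tau>)"
  by (rule tail_from_via; simp add: pascal_edges_def)+

lemma same_tail_edge:
  assumes "\<gamma> \<in> same_tail (Suc n) \<tau>" "tail_from x y \<tau>" "x + y = Suc n"
  shows "\<gamma> n \<in> pascal_edges" "snd (\<gamma> n) = (x, y)"
  using assms by (auto simp: same_tail_def tail_from_def paths_def) (metis order_refl)

lemma set_fan: "tail_from x y \<tau> \<Longrightarrow> set (fan \<xi> x y \<tau>) = same_tail (x + y) \<tau>"
proof (induction \<xi> x y \<tau> rule: fan_induct)
  case (root \<xi> \<tau>)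
  then show ?case by (auto simp: same_tail_def tail_from_def paths_def)
next
  case (bottom \<xi> x \<tau>)
  have "\<gamma> x = ((x, 0), (Suc x, 0))" if "\<gamma> \<in> same_tail (Suc x) \<tau>" for \<gamma>
    using same_tail_edge[OF that bottom.prems] by (auto simp: pascal_edges_def)
  then show ?case
    using bottom.IH[OF tail_from_pred(1)[OF bottom.prems]] same_tail_via[of x 0] by auto
next
  case (left \<xi> y \<tau>)
  have "\<gamma> y = ((0, y), (0, Suc y))" if "\<gamma> \<in> same_tail (Suc y) \<tau>" for \<gamma>
    using same_tail_edge[OF that left.prems] by (auto simp: pascal_edges_def)
  then show ?case
    using left.IH[OF tail_from_pred(2)[OF left.prems]] same_tail_via[of 0 y] by auto
next
  case (inner \<xi> x y \<tau>)
  let ?n = "Suc (x + y)"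
  let ?h = "((x, Suc y), (Suc x, Suc y)) :: edge"
  let ?v = "((Suc x, y), (Suc x, Suc y)) :: edge"
  have IH: "set (fan \<xi> x (Suc y) (via ?h \<tau>)) = {\<gamma> \<in> same_tail (Suc ?n) \<tau>. \<gamma> ?n = ?h}"
    "set (fan \<xi> (Suc x) y (via ?v \<tau>)) = {\<gamma> \<in> same_tail (Suc ?n) \<tau>. \<gamma> ?n = ?v}"
    using inner.IH tail_from_pred inner.prems same_tail_via[of x "Suc y"]
      same_tail_via[of "Suc x" y] by simp_all
  have "\<gamma> ?n = ?h \<or> \<gamma> ?n = ?v" if "\<gamma> \<in> same_tail (Suc ?n) \<tau>" for \<gamma>
    using same_tail_edge[OF that inner.prems] by (auto simp: pascal_edges_def)
  then have "same_tail (Suc ?n) \<tau> =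
      set (fan \<xi> x (Suc y) (via ?h \<tau>)) \<union> set (fan \<xi> (Suc x) y (via ?v \<tau>))"
    unfolding IH by blast
  then show ?case by (simp add: append_if_def Un_commute)
qed

lemma fan_nonempty: "fan \<xi> x y \<tau> \<noteq> []"
  by (induction \<xi> x y \<tau> rule: fan_induct) (simp_all add: append_if_def)

lemma path_less_at:
  assumes "\<gamma> \<in> same_tail (Suc n) \<tau>" "\<eta> \<in> same_tail (Suc n) \<tau>" "edge_less \<xi> (\<gamma> n) (\<eta> n)"
  shows "path_less \<xi> \<gamma> \<eta>"
  unfolding path_less_def using assms edge_lessD(4)[OF assms(3)]
  by (intro exI[of _ n]) (auto simp: same_tail_def)

lemma sorted_fan: "tail_from x y \<tau> \<Longrightarrow> sorted_wrt (path_less \<xi>) (fan \<xi> x y \<tau>)"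
proof (induction \<xi> x y \<tau> rule: fan_induct)
  case (inner \<xi> x y \<tau>)
  let ?n = "Suc (x + y)"
  let ?h = "((x, Suc y), (Suc x, Suc y)) :: edge"
  let ?v = "((Suc x, y), (Suc x, Suc y)) :: edge"
  have h: "\<gamma> \<in> same_tail (Suc ?n) \<tau>" "\<gamma> ?n = ?h" if "\<gamma> \<in> set (fan \<xi> x (Suc y) (via ?h \<tau>))" for \<gamma>
    using that set_fan[OF tail_from_pred(1)[OF inner.prems]] same_tail_via[of x "Suc y"] by auto
  have v: "\<gamma> \<in> same_tail (Suc ?n) \<tau>" "\<gamma> ?n = ?v" if "\<gamma> \<in> set (fan \<xi> (Suc x) y (via ?v \<tau>))" for \<gamma>
    using that set_fan[OF tail_from_pred(2)[OF inner.prems]] same_tail_via[of "Suc x" y] by auto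
  have "path_less \<xi> \<gamma> \<eta>" if "\<xi> (Suc x, Suc y)"
    "\<gamma> \<in> set (fan \<xi> x (Suc y) (via ?h \<tau>))" "\<eta> \<in> set (fan \<xi> (Suc x) y (via ?v \<tau>))" for \<gamma> \<eta>
    using that by (intro path_less_at[of _ ?n \<tau>]) (simp_all add: h v edge_less_into_Suc)
  moreover have "path_less \<xi> \<gamma> \<eta>" if "\<not> \<xi> (Suc x, Suc y)"
    "\<gamma> \<in> set (fan \<xi> (Suc x) y (via ?v \<tau>))" "\<eta> \<in> set (fan \<xi> x (Suc y) (via ?h \<tau>))" for \<gamma> \<eta>
    using that by (intro path_less_at[of _ ?n \<tau>]) (simp_all add: h v edge_less_into_Suc)
  ultimately show ?case
    using inner.IH tail_from_pred inner.prems by (simp add: append_if_def sorted_wrt_append)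
qed (simp_all add: tail_from_pred)

section \<open>The adic map along such a list\<close>

lemma nth_fan_less_iff:
  assumes "tail_from x y \<tau>" "i < length (fan \<xi> x y \<tau>)" "j < length (fan \<xi> x y \<tau>)"
  shows "path_less \<xi> (fan \<xi> x y \<tau> ! i) (fan \<xi> x y \<tau> ! j) \<longleftrightarrow> i < j"
  using sorted_wrt_nth_less[OF sorted_fan[OF assms(1), of \<xi>]] assms(2,3)
    path_less_asym path_less_irrefl by (metis linorder_neqE_nat)

lemma is_next_path_unique:
  "is_next_path \<xi> \<gamma> \<eta> \<Longrightarrow> is_next_path \<xi> \<gamma> \<eta>' \<Longrightarrow> \<eta> = \<eta>'"
  unfolding is_next_path_def using path_less_asym by metis

text \<open>Two paths with the same successor are cofinal, hence comparable; the larger one would lie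
  strictly between the smaller one and its successor.\<close>

lemma is_next_path_inj:
  assumes "\<gamma> \<in> paths" "\<gamma>' \<in> paths" and "is_next_path \<xi> \<gamma> \<eta>" "is_next_path \<xi> \<gamma>' \<eta>"
  shows "\<gamma> = \<gamma>'"
proof (rule ccontr)
  have less: "path_less \<xi> \<gamma> \<eta>" "path_less \<xi> \<gamma>' \<eta>"
    using assms(3,4) by (auto simp: is_next_path_def)
  obtain m n where "\<forall>l>m. \<gamma> l = \<eta> l" "\<forall>l>n. \<gamma>' l = \<eta> l"
    using less unfolding path_less_def by blast
  then have "\<forall>l\<ge>Suc (m + n). \<gamma> l = \<gamma>' l" by (auto simp: Suc_le_eq)
  moreover assume "\<gamma> \<noteq> \<gamma>'"
  ultimately have "path_less \<xi> \<gamma> \<gamma>' \<or> path_less \<xi> \<gamma>' \<gamma>"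
    using path_less_total assms(1,2) by blast
  then show False
    using assms less path_less_asym path_less_irrefl unfolding is_next_path_def by metis
qed

text \<open>A path above \<open>fan \<xi> x y \<tau> ! i\<close> that is not in the list differs from \<open>\<tau>\<close> at or after the level
  of \<open>(x, y)\<close>, where all members of the list agree. Hence it lies above every one of them.\<close>

lemma is_next_path_fan:
  assumes "tail_from x y \<tau>" "Suc i < length (fan \<xi> x y \<tau>)"
  shows "is_next_path \<xi> (fan \<xi> x y \<tau> ! i) (fan \<xi> x y \<tau> ! Suc i)"
proof -
  let ?xs = "fan \<xi> x y \<tau>"
  have mem: "?xs ! j \<in> same_tail (x + y) \<tau>" if "j < length ?xs" for j
    using that nth_mem set_fan[OF assms(1)] by blast
  have tail: "(?xs ! i) m = \<tau> m" "(?xs ! Suc i) m = \<tau> m" if "m \<ge> x + y" for m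
    using that mem[of i] mem[of "Suc i"] assms(2) by (auto simp: same_tail_def)
  have "?xs ! Suc i = \<zeta> \<or> path_less \<xi> (?xs ! Suc i) \<zeta>"
    if \<zeta>: "\<zeta> \<in> paths" "path_less \<xi> (?xs ! i) \<zeta>" for \<zeta>
  proof -
    obtain n where n: "(?xs ! i) n \<noteq> \<zeta> n" "\<forall>m>n. (?xs ! i) m = \<zeta> m"
      "edge_less \<xi> ((?xs ! i) n) (\<zeta> n)"
      using \<zeta>(2) unfolding path_less_def by blast
    show ?thesis
    proof (cases "n \<ge> x + y")
      case True
      then have "path_less \<xi> (?xs ! Suc i) \<zeta>"
        unfolding path_less_def using n tail by (intro exI[of _ n]) auto
      then show ?thesis ..
    next
      case False
      then have "\<zeta> \<in> same_tail (x + y) \<tau>"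
        using n(2) tail(1) \<zeta>(1) by (auto simp: same_tail_def)
      then obtain j where j: "j < length ?xs" "?xs ! j = \<zeta>"
        using set_fan[OF assms(1)] by (metis in_set_conv_nth)
      then have "i < j" using nth_fan_less_iff[OF assms(1), of i \<xi> j] \<zeta>(2) assms(2) by simp
      then show ?thesis
        using nth_fan_less_iff[OF assms(1), of "Suc i" \<xi> j] j assms(2)
        by (metis Suc_lessI)
    qed
  qed
  then show ?thesis
    unfolding is_next_path_def
    using nth_fan_less_iff[OF assms(1), of i \<xi> "Suc i"] mem[of "Suc i"] assms(2)
    by (auto simp: same_tail_def)
qed

text \<open>The path lies in the list for the target of a non-maximal edge of it, and not at the end of
  that list, because the paths through the larger edge come later.\<close>

lemma ex_next_path:
  assumes "\<gamma> \<in> paths" "\<not> (\<forall>n. maximal_edge \<xi> (\<gamma> n))"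
  shows "\<exists>\<eta>. is_next_path \<xi> \<gamma> \<eta>"
proof -
  obtain n f where nf: "edge_less \<xi> (\<gamma> n) f"
    using assms path_edge unfolding maximal_edge_def by blast
  obtain x y where xy: "snd (\<gamma> n) = (x, y)" by fastforce
  obtain x' y' where f: "f = ((x', y'), (x, y))"
    using edge_lessD(3)[OF nf] xy by (metis prod.collapse snd_conv)
  have lev: "x + y = Suc n" "x' + y' = n"
    using path_level[OF assms(1), of "Suc n"] path_step[OF assms(1), of n] xy
      edge_lessD(2)[OF nf] f by (auto simp: pascal_edges_def)
  have tl: "tail_from x y \<gamma>"
    using path_step[OF assms(1), of n] xy lev by (intro tail_from_path[OF assms(1)]) simp
  have "same_tail n (via f \<gamma>) \<noteq> {}"
    using set_fan[OF tail_from_via[OF tl]] edge_lessD(2)[OF nf] fan_nonempty[of \<xi> x' y'] f lev(2)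
    by (metis set_empty)
  then obtain \<eta> where \<eta>: "\<eta> \<in> same_tail (Suc n) \<gamma>" "\<eta> n = f"
    using same_tail_via[of x' y'] lev(2) f by auto
  then have "path_less \<xi> \<gamma> \<eta>"
    using path_less_at[of \<gamma> n \<gamma> \<eta> \<xi>] nf assms(1) by (simp add: same_tail_def)
  have "\<gamma> \<in> set (fan \<xi> x y \<gamma>)"
    using set_fan[OF tl] assms(1) by (auto simp: same_tail_def)
  moreover have "\<eta> \<in> set (fan \<xi> x y \<gamma>)"
    using set_fan[OF tl] \<eta> lev(1) by simp
  ultimately obtain i j where ij: "i < length (fan \<xi> x y \<gamma>)" "fan \<xi> x y \<gamma> ! i = \<gamma>"
      "j < length (fan \<xi> x y \<gamma>)" "fan \<xi> x y \<gamma> ! j = \<eta>"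
    by (metis in_set_conv_nth)
  then have "i < j" using nth_fan_less_iff[OF tl, of i \<xi> j] \<open>path_less \<xi> \<gamma> \<eta>\<close> by simp
  then show ?thesis using is_next_path_fan[OF tl, of i \<xi>] ij by auto
qed

lemma path_less_not_extremal:
  assumes "path_less \<xi> \<gamma> \<eta>"
  shows "\<not> (\<forall>n. maximal_edge \<xi> (\<gamma> n))" "\<not> (\<forall>n. minimal_edge \<xi> (\<eta> n))"
  using assms unfolding path_less_def maximal_edge_def minimal_edge_def by blast+

lemma adic_eq:
  assumes "is_next_path \<xi> \<gamma> \<eta>" shows "adic \<xi> \<gamma> = Some \<eta>"
proof -
  have "(THE \<eta>. is_next_path \<xi> \<gamma> \<eta>) = \<eta>"
    using assms is_next_path_unique by (intro the_equality)
  then show ?thesis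
    using assms path_less_not_extremal unfolding adic_def is_next_path_def by auto
qed

lemma adic_SomeD:
  assumes "\<gamma> \<in> paths" "adic \<xi> \<gamma> = Some \<eta>" shows "is_next_path \<xi> \<gamma> \<eta>"
proof -
  have "\<not> (\<forall>n. maximal_edge \<xi> (\<gamma> n))"
    using assms(2) unfolding adic_def by (metis option.distinct(1))
  then show ?thesis using ex_next_path[OF assms(1)] adic_eq assms(2) by fastforce
qed

text \<open>The inverse is a definite description among all paths that the adic map sends to \<open>\<eta>\<close>; that
  they have \<open>\<eta>\<close> as their successor rests on the existence of successors in general.\<close>

lemma adic_inv_eq:
  assumes "\<gamma> \<in> paths" "is_next_path \<xi> \<gamma> \<eta>" shows "adic_inv \<xi> \<eta> = Some \<gamma>"
proof -
  have "(THE \<gamma>. \<gamma> \<in> paths \<and> adic \<xi> \<gamma> = Some \<eta>) = \<gamma>"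
    using assms adic_eq adic_SomeD is_next_path_inj by (intro the_equality) blast+
  then show ?thesis
    using assms path_less_not_extremal unfolding adic_inv_def is_next_path_def by auto
qed

lemma adic_pow_fan:
  assumes tl: "tail_from x y \<tau>" and i: "i < length (fan \<xi> x y \<tau>)"
    and j: "0 \<le> int i + j" "int i + j < int (length (fan \<xi> x y \<tau>))"
  shows "adic_pow \<xi> j (fan \<xi> x y \<tau> ! i) = Some (fan \<xi> x y \<tau> ! nat (int i + j))"
proof -
  let ?xs = "fan \<xi> x y \<tau>"
  have paths: "?xs ! l \<in> paths" if "l < length ?xs" for l
    using that nth_mem set_fan[OF tl] unfolding same_tail_def by blast
  have forward: "((\<lambda>p. Option.bind p (adic \<xi>)) ^^ m) (Some (?xs ! i)) = Some (?xs ! (i + m))"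
    if "i + m < length ?xs" for m
    using that by (induction m) (auto simp: adic_eq[OF is_next_path_fan[OF tl]])
  have backward: "((\<lambda>p. Option.bind p (adic_inv \<xi>)) ^^ m) (Some (?xs ! i)) = Some (?xs ! (i - m))"
    if "m \<le> i" for m
    using that
  proof (induction m)
    case (Suc m)
    then have "Suc (i - Suc m) = i - m" by simp
    then have "adic_inv \<xi> (?xs ! (i - m)) = Some (?xs ! (i - Suc m))"
      using adic_inv_eq[OF paths is_next_path_fan[OF tl], of "i - Suc m"] i by simp
    then show ?case using Suc by simp
  qed simp
  show ?thesis
  proof (cases "j \<ge> 0")
    case True
    then have "nat (int i + j) = i + nat j" by simp
    then show ?thesis using True j forward[of "nat j"] by (simp add: adic_pow_def)
  next
    case False
    then have "nat (int i + j) = i - nat (- j)" by simp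
    then show ?thesis using False j backward[of "nat (- j)"] by (simp add: adic_pow_def)
  qed
qed

section \<open>Basic blocks\<close>

definition first_letter :: "path \<Rightarrow> letter" where
  "first_letter \<gamma> = (if \<gamma> 0 = ((0, 0), (1, 0)) then letter_a else letter_b)"

text \<open>The coding of the list of paths through \<open>(x, y)\<close>. The value at the root is a dummy, as the
  letter is only determined by the edge leaving it.\<close>

fun basic_block :: "ordering \<Rightarrow> nat \<Rightarrow> nat \<Rightarrow> letter list" where
  "basic_block \<xi> 0 0 = [letter_a]"
| "basic_block \<xi> (Suc x) 0 = [letter_a]"
| "basic_block \<xi> 0 (Suc y) = [letter_b]"
| "basic_block \<xi> (Suc x) (Suc y) =
     (if \<xi> (Suc x, Suc y) then basic_block \<xi> x (Suc y) @ basic_block \<xi> (Suc x) y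
      else basic_block \<xi> (Suc x) y @ basic_block \<xi> x (Suc y))"

lemma first_letter_via:
  "first_letter (via ((0, 0), v) \<tau>) = (if v = (1, 0) then letter_a else letter_b)"
  by (simp add: first_letter_def via_def)

lemma first_letters_fan:
  "0 < x + y \<Longrightarrow> map first_letter (fan \<xi> x y \<tau>) = basic_block \<xi> x y"
proof (induction \<xi> x y \<tau> rule: fan_induct)
  case (bottom \<xi> x \<tau>)
  then show ?case by (cases x) (simp_all add: first_letter_via)
next
  case (left \<xi> y \<tau>)
  then show ?case by (cases y) (simp_all add: first_letter_via)
qed (simp_all add: append_if_def)

lemma length_basic_block: "length (basic_block \<xi> x y) = (x + y) choose x"
proof (induction \<xi> x y rule: basic_block.induct)
  case (4 \<xi> x y)
  then show ?case by (simp add: add.commute)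
qed simp_all

text \<open>If the orbit of \<open>\<gamma>\<close> is infinite in both directions, then its coding is itself a point of the
  subshift. The last assumption grants this: every iterate of \<open>\<gamma>\<close> is met in some list that has \<open>\<gamma>\<close>
  far enough from both ends.\<close>

lemma basic_block_in_lang:
  assumes \<gamma>: "\<gamma> \<in> paths" and xy: "fst (\<gamma> (x + y)) = (x, y)" "0 < x + y"
    and deep: "\<And>N. \<exists>x y i. tail_from x y \<gamma> \<and> fan \<xi> x y \<gamma> ! i = \<gamma> \<and> N \<le> i \<and>
      i + N < length (fan \<xi> x y \<gamma>)"
  shows "basic_block \<xi> x y \<in> lang (ordering_subshift \<xi>)"
proof -
  define s where "s j = the (coding1 \<xi> \<gamma> j)" for j
  have coding: "coding1 \<xi> \<gamma> j = Some (s j)" for j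
  proof -
    obtain x y i where tl: "tail_from x y \<gamma>" and i: "fan \<xi> x y \<gamma> ! i = \<gamma>" "nat \<bar>j\<bar> \<le> i"
        "i + nat \<bar>j\<bar> < length (fan \<xi> x y \<gamma>)"
      using deep by blast
    then have "adic_pow \<xi> j \<gamma> \<noteq> None"
      using adic_pow_fan[OF tl, of i \<xi> j] by simp
    then show ?thesis by (auto simp: s_def coding1_def)
  qed
  have "block_in_coding (block_at s i n) (coding1 \<xi> \<gamma>)" for i n
    unfolding block_in_coding_def using coding by (intro exI[of _ i]) (simp add: block_at_def)
  then have s: "s \<in> ordering_subshift \<xi>"
    unfolding ordering_subshift_def using \<gamma> by blast
  let ?xs = "fan \<xi> x y \<gamma>"
  have tl: "tail_from x y \<gamma>" using tail_from_path[OF \<gamma> xy(1)] .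
  then have "\<gamma> \<in> set ?xs" using set_fan \<gamma> by (auto simp: same_tail_def)
  then obtain i where i: "i < length ?xs" "?xs ! i = \<gamma>" by (metis in_set_conv_nth)
  have "s (- int i + int j) = first_letter (?xs ! j)" if "j < length ?xs" for j
    using adic_pow_fan[OF tl i(1), of "- int i + int j"] that i(2)
    by (simp add: s_def coding1_def first_letter_def)
  then have "block_at s (- int i) (length ?xs) = map first_letter ?xs"
    by (intro nth_equalityI) (auto simp: block_at_def)
  also have "\<dots> = basic_block \<xi> x y" using first_letters_fan[OF xy(2)] .
  finally show ?thesis unfolding lang_def using s by (metis (mono_tags, lifting) mem_Collect_eq)
qed

section \<open>Many basic blocks in the second row\<close>

text \<open>The first row is ordered so that its basic blocks are \<open>a\<^sup>x b\<close>, the second row is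
  free, and from the third row on the order alternates along every column.\<close>

definition row_ordering :: "nat set \<Rightarrow> ordering" where
  "row_ordering A = (\<lambda>(x, y). if y = 1 then False else if y = 2 then x \<in> A else even y)"

definition corner_path :: "nat \<Rightarrow> path" where
  "corner_path k n = (if n < k then ((n, 0), (Suc n, 0)) else ((k, n - k), (k, Suc (n - k))))"

lemma corner_path: "corner_path k \<in> paths" "fst (corner_path k (k + y)) = (k, y)"
  by (auto simp: corner_path_def paths_def pascal_edges_def Suc_diff_le)

text \<open>Going up one step in the column extends the list on one side, and the alternation makes this
  happen on both sides in turn.\<close>

lemma corner_path_deep:
  assumes "k > 0"
  shows "\<exists>y i. even y \<and> 2 \<le> y \<and> fan (row_ordering A) k y (corner_path k) ! i = corner_path k \<and>
    N \<le> i \<and> i + N < length (fan (row_ordering A) k y (corner_path k))"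
proof (induction N)
  case 0
  let ?\<gamma> = "corner_path k"
  have "?\<gamma> \<in> set (fan (row_ordering A) k 2 ?\<gamma>)"
    using set_fan[OF tail_from_path[OF corner_path]] corner_path by (auto simp: same_tail_def)
  then obtain i where "i < length (fan (row_ordering A) k 2 ?\<gamma>)"
      "fan (row_ordering A) k 2 ?\<gamma> ! i = ?\<gamma>"
    by (metis in_set_conv_nth)
  then show ?case by (intro exI[of _ 2] exI[of _ i]) auto
next
  case (Suc N)
  let ?\<gamma> = "corner_path k" and ?\<xi> = "row_ordering A"
  obtain y i where y: "even y" "2 \<le> y" and i: "fan ?\<xi> k y ?\<gamma> ! i = ?\<gamma>" "N \<le> i"
      "i + N < length (fan ?\<xi> k y ?\<gamma>)"
    using Suc.IH by blast
  obtain k' where k: "k = Suc k'" using assms gr0_implies_Suc by blast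
  have via: "via ((k, z), (k, Suc z)) ?\<gamma> = ?\<gamma>" for z
    by (auto simp: fun_eq_iff corner_path_def via_def)
  \<comment> \<open>Since \<open>y\<close> is even, the order at \<open>(k, y + 1)\<close> puts the new paths last and the order at
    \<open>(k, y + 2)\<close> puts them first.\<close>
  define p q where "p = fan ?\<xi> k' (Suc y) (via ((k', Suc y), (k, Suc y)) ?\<gamma>)"
    and "q = fan ?\<xi> k' (Suc (Suc y)) (via ((k', Suc (Suc y)), (k, Suc (Suc y))) ?\<gamma>)"
  have "fan ?\<xi> k (Suc (Suc y)) ?\<gamma> = q @ fan ?\<xi> k y ?\<gamma> @ p"
    using y via unfolding p_def q_def k by (simp add: row_ordering_def append_if_def)
  moreover have "p \<noteq> []" "q \<noteq> []" by (auto simp: p_def q_def fan_nonempty)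
  ultimately show ?case
    using y i by (intro exI[of _ "Suc (Suc y)"] exI[of _ "length q + i"])
      (auto simp: nth_append Suc_le_eq neq_Nil_conv)
qed

lemma row_block_in_lang:
  assumes "k > 0"
  shows "basic_block (row_ordering A) k 2 \<in> lang big_subshift"
proof -
  have "basic_block (row_ordering A) k 2 \<in> lang (ordering_subshift (row_ordering A))"
  proof (rule basic_block_in_lang)
    fix N
    obtain y i where "fan (row_ordering A) k y (corner_path k) ! i = corner_path k" "N \<le> i"
        "i + N < length (fan (row_ordering A) k y (corner_path k))"
      using corner_path_deep[OF assms] by blast
    moreover have "tail_from k y (corner_path k)" using tail_from_path corner_path .
    ultimately show "\<exists>x y i. tail_from x y (corner_path k) \<and>
        fan (row_ordering A) x y (corner_path k) ! i = corner_path k \<and> N \<le> i \<and>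
        i + N < length (fan (row_ordering A) x y (corner_path k))" by blast
  qed (use corner_path(1) corner_path(2)[of k 2] assms in simp_all)
  then show ?thesis unfolding lang_big_subshift by blast
qed

lemma first_row_block: "basic_block (row_ordering A) x 1 = replicate x letter_a @ [letter_b]"
  by (induction x) (auto simp: row_ordering_def)

lemma second_row_block:
  "basic_block (row_ordering A) (Suc x) 2 =
    (if Suc x \<in> A
     then basic_block (row_ordering A) x 2 @ replicate (Suc x) letter_a @ [letter_b]
     else (replicate (Suc x) letter_a @ [letter_b]) @ basic_block (row_ordering A) x 2)"
proof -
  have "row_ordering A (Suc x, Suc (Suc 0)) \<longleftrightarrow> Suc x \<in> A" by (simp add: row_ordering_def)
  then show ?thesis
    using first_row_block[of A "Suc x"] unfolding numeral_2_eq_2 One_nat_def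
    by (simp del: replicate_Suc)
qed

text \<open>The initial run of \<open>a\<close> in the block at \<open>(x, 2)\<close> is shorter than \<open>Suc x\<close>, so such a block cannot
  be mistaken for one that begins with the piece attached in the next column.\<close>

lemma second_row_block_start:
  "\<exists>j\<le>x. \<exists>w. basic_block (row_ordering A) x 2 = replicate j letter_a @ letter_b # w"
proof (induction x)
  case 0
  show ?case by (simp add: numeral_2_eq_2)
next
  case (Suc x)
  then obtain j w where "j \<le> x"
    "basic_block (row_ordering A) x 2 = replicate j letter_a @ letter_b # w" by blast
  then show ?case
    unfolding second_row_block
    by (cases "Suc x \<in> A") (auto intro: exI[of _ j] exI[of _ "Suc x"])
qed

text \<open>The run \<open>a\<^sup>k\<close> occurs only once in the basic block at \<open>(k, 2)\<close>, either at the start or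
  just before the last letter. Its position tells whether \<open>k \<in> A\<close>, and removing \<open>a\<^sup>k b\<close> leaves
  the basic block at \<open>(k - 1, 2)\<close>.\<close>

lemma second_row_block_inj:
  "basic_block (row_ordering A) k 2 = basic_block (row_ordering B) k 2 \<Longrightarrow>
    A \<inter> {1..k} = B \<inter> {1..k}"
proof (induction k)
  case (Suc k)
  let ?u = "replicate (Suc k) letter_a @ [letter_b]"
  have ne: "basic_block (row_ordering C) k 2 @ ?u \<noteq> ?u @ w" for C w
  proof
    assume eq: "basic_block (row_ordering C) k 2 @ ?u = ?u @ w"
    obtain j v where j: "j \<le> k"
      "basic_block (row_ordering C) k 2 = replicate j letter_a @ letter_b # v"
      using second_row_block_start by blast
    have "(?u @ w) ! j = letter_a" using j(1) by (simp add: nth_append del: replicate_Suc)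
    moreover have "(basic_block (row_ordering C) k 2 @ ?u) ! j = letter_b"
      unfolding j(2) by (simp add: nth_append)
    ultimately show False unfolding eq by simp
  qed
  have same: "Suc k \<in> A \<longleftrightarrow> Suc k \<in> B"
    using Suc.prems ne[of A] ne[of B] unfolding second_row_block by metis
  then have "basic_block (row_ordering A) k 2 = basic_block (row_ordering B) k 2"
    using Suc.prems unfolding second_row_block by (auto split: if_splits)
  then show ?case using Suc.IH same by (simp add: atLeastAtMostSuc_conv) blast
qed simp

section \<open>Counting\<close>

instance letter :: finite
proof
  have "(UNIV :: letter set) = {letter_a, letter_b}" using letter.exhaust by blast
  then show "finite (UNIV :: letter set)" by (metis finite.emptyI finite.insertI)
qed

lemma finite_lang_length: "finite {w \<in> lang (\<Omega> :: (int \<Rightarrow> 'a :: finite) set). length w = n}"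
  using finite_lists_length_eq[of "UNIV :: 'a set" n] by (auto intro: finite_subset[rotated])

lemma complexity_mono:
  fixes \<Omega> :: "(int \<Rightarrow> 'a :: finite) set"
  assumes "m \<le> n" shows "complexity \<Omega> m \<le> complexity \<Omega> n"
proof -
  have "w \<in> take m ` {w \<in> lang \<Omega>. length w = n}" if w: "w \<in> lang \<Omega>" "length w = m" for w
  proof -
    obtain s i l where s: "s \<in> \<Omega>" "w = block_at s i l"
      using w(1) unfolding lang_def by blast
    then have "l = m" using w(2) by (simp add: block_at_def)
    then have "w = take m (block_at s i n)"
      unfolding s(2) using assms by (simp add: block_at_def take_map)
    moreover have "block_at s i n \<in> lang \<Omega>" using s(1) unfolding lang_def by blast
    moreover have "length (block_at s i n) = n" by (simp add: block_at_def)
    ultimately show ?thesis by blast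
  qed
  then show ?thesis
    unfolding complexity_def by (intro surj_card_le[where f = "take m"] finite_lang_length) auto
qed

lemma complexity_ge:
  assumes "k > 0"
  shows "2 ^ k \<le> complexity big_subshift ((k + 1) * (k + 2) div 2)"
proof -
  let ?B = "\<lambda>A. basic_block (row_ordering A) k 2"
  have "length (?B A) = (k + 1) * (k + 2) div 2" for A
  proof -
    have "(k + 2) choose k = (k + 2) choose 2" using binomial_symmetric[of k "k + 2"] by simp
    then show ?thesis unfolding length_basic_block choose_two by (simp add: mult.commute)
  qed
  then have "?B ` Pow {1..k} \<subseteq> {w \<in> lang big_subshift. length w = (k + 1) * (k + 2) div 2}"
    using row_block_in_lang[OF assms] by auto
  moreover have "inj_on ?B (Pow {1..k})"
    using second_row_block_inj by (intro inj_onI) (metis Int_absorb2 PowD)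
  ultimately have "card (Pow {1..k}) \<le> complexity big_subshift ((k + 1) * (k + 2) div 2)"
    unfolding complexity_def by (intro card_inj_on_le finite_lang_length)
  then show ?thesis by (simp add: card_Pow)
qed

text \<open>Monotonicity bridges the gaps between the lengths in the hypothesis: with
  \<open>k = \<lfloor>sqrt n\<rfloor>\<close> one has \<open>(k + 1) (k + 2) / 2 \<le> k\<^sup>2 \<le> n\<close> as soon as \<open>k \<ge> 4\<close>.\<close>

lemma superpolynomial_complexity:
  fixes \<Omega> :: "(int \<Rightarrow> 'a :: finite) set"
  assumes "\<And>k. k > 0 \<Longrightarrow> 2 ^ k \<le> complexity \<Omega> ((k + 1) * (k + 2) div 2)"
  shows "superpolynomial (\<lambda>n. real (complexity \<Omega> n))"
proof -
  have lower: "2 powr (sqrt (real n) - 1) \<le> real (complexity \<Omega> n)" if n: "n \<ge> 16" for n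
  proof -
    define k where "k = floor_sqrt n"
    have "4 \<le> k" unfolding k_def using n by (intro le_floor_sqrtI) simp
    have "k\<^sup>2 \<le> n" "n < (Suc k)\<^sup>2" unfolding k_def by (simp_all add: Suc_floor_sqrt_power2_gt)
    have "4 * k \<le> k * k" using \<open>4 \<le> k\<close> by simp
    moreover have "(k + 1) * (k + 2) = k * k + 3 * k + 2" by (simp add: algebra_simps)
    ultimately have "(k + 1) * (k + 2) div 2 \<le> n"
      using \<open>4 \<le> k\<close> \<open>k\<^sup>2 \<le> n\<close> unfolding power2_eq_square by linarith
    then have "2 ^ k \<le> complexity \<Omega> n"
      using assms[of k] complexity_mono[of _ n \<Omega>] \<open>4 \<le> k\<close>
      by (meson less_le_trans order_trans zero_less_numeral)
    then have "real (2 ^ k) \<le> real (complexity \<Omega> n)" using of_nat_le_iff by blast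
    then have "2 powr real k \<le> real (complexity \<Omega> n)" by (simp add: powr_realpow)
    moreover have "sqrt (real n) \<le> real k + 1"
    proof -
      have "real n \<le> real ((Suc k)\<^sup>2)"
        using \<open>n < (Suc k)\<^sup>2\<close> unfolding of_nat_le_iff by simp
      then show ?thesis by (intro real_le_lsqrt) (simp_all add: add.commute)
    qed
    then have "2 powr (sqrt (real n) - 1) \<le> (2 :: real) powr real k" by (intro powr_mono) auto
    ultimately show ?thesis by linarith
  qed
  have big: "(\<lambda>n. 2 powr (sqrt (real n) - 1)) \<in> O(\<lambda>n. real (complexity \<Omega> n))"
    using lower by (intro bigoI[of _ 1] eventually_sequentiallyI[of 16]) auto
  have "(\<lambda>n. real n ^ i) \<in> o(\<lambda>n. 2 powr (sqrt (real n) - 1))" for i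
    by real_asymp
  then have "(\<lambda>n. real n ^ i) \<in> o(\<lambda>n. real (complexity \<Omega> n))" for i
    using big landau_o.small_big_trans by blast
  then have "(\<lambda>n. poly q (real n)) \<in> o(\<lambda>n. real (complexity \<Omega> n))" for q
    unfolding poly_altdef by (intro big_sum_in_smallo) simp
  then show ?thesis unfolding superpolynomial_def by blast
qed

theorem proposition6p4:
  shows "superpolynomial (\<lambda>n. real (complexity big_subshift n)) \<and>
    (\<forall>k\<ge>(2::nat). complexity big_subshift ((k + 1) * (k + 2) div 2) \<ge> 2 ^ (k - 1))"
proof (intro conjI allI impI)
  show "superpolynomial (\<lambda>n. real (complexity big_subshift n))"
    using superpolynomial_complexity complexity_ge by blast
  fix k :: nat assume "2 \<le> k"
  then have "(2 :: nat) ^ (k - 1) \<le> 2 ^ k" by (intro power_increasing) auto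
  then show "2 ^ (k - 1) \<le> complexity big_subshift ((k + 1) * (k + 2) div 2)"
    using complexity_ge[of k] \<open>2 \<le> k\<close> by linarith
qed

end
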